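(* Let $X$ be a chaos eigenfunction of order $p$ with respect to $-\mathbf{L}$ and assume that $\lambda_{2p}\le 2\lambda_p$. Then $$\int_E\left(\Gamma(X)-\lambda_p\right)^2d\mu\le\frac{\lambda_p^2}{3}\left(m_4(X)-6\,m_2(X)+3\right).$$
   Context: $(E,\mathcal{F},\mu)$ is a probability space and $-\mathbf{L}$ is a symmetric Markov generator with state space $E$ and invariant probability measure $\mu$: $\mathbf{L}$ is a (possibly unbounded) self-adjoint linear operator on the real space $L^2(E,\mu)$ with $\mathbf{L}1=0$. $-\mathbf{L}$ has discrete spectrum $\{\lambda_k\}_{k\ge 0}$, $0=\lambda_0<\lambda_1<\lambda_2<\cdots$, and $L^2(E,\mu)=\bigoplus_{k=0}^\infty\mathrm{Ker}(\mathbf{L}+\lambda_k\mathbf{Id})$ (orthogonal sum). The carré du champ operator is $\Gamma(X,Y)=\frac12(\mathbf{L}(XY)-X\mathbf{L}Y-Y\mathbf{L}X)$, $\Gamma(X)=\Gamma(X,X)$. It satisfies the integration by parts formula $\int_E\Gamma(X,Y)\,d\mu=-\int_E X\mathbf{L}Y\,d\mu=-\int_E Y\mathbf{L}X\,d\mu$. $\mathbf{L}$ is assumed diffusive: for smooth $\phi:\mathbb{R}\to\mathbb{R}$, $\mathbf{L}\phi(X)=\phi'(X)\mathbf{L}X+\phi''(X)\Gamma(X)$; equivalently $\Gamma(\phi(X),X)=\phi'(X)\Gamma(X)$ (and $\Gamma(\phi(X))=\phi'(X)^2\Gamma(X)$). The integration by parts formula $\int_E\Gamma(X,Y)\,d\mu=-\int_E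 X\mathbf{L}Y\,d\mu=-\int_E Y\mathbf{L}X\,d\mu$, the diffusion identity $\mathbf{L}\phi(X)=\phi'(X)\mathbf{L}X+\phi''(X)\Gamma(X)$, and the derivation identities $\Gamma(\phi(X),X)=\phi'(X)\Gamma(X)$ and $\Gamma(\phi(X))=\phi'(X)^2\Gamma(X)$ are assumed for all functions for which the expressions make sense, in particular for $X$ an eigenfunction of $\mathbf{L}$ and $\phi$ a polynomial or a bounded smooth function with bounded derivatives. The eigenspaces are assumed hypercontractive: for each $k$ and each $r\ge 2$ there is a finite constant $C_{k,r}$ with $\|X\|_{L^r(E,\mu)}\le C_{k,r}\|X\|_{L^2(E,\mu)}$ for all $X\in\mathrm{Ker}(\mathbf{L}+\lambda_k\mathbf{Id})$. Chaos eigenfunction: $X$ is a chaos eigenfunction of order $p$ if $\mathbf{L}X=-\lambda_pX$ and $X^2\in\bigoplus_{k=0}^{2p}\mathrm{Ker}(\mathbf{L}+\lambda_k\mathbf{Id})$. Moments: $m_k(X)=\int_E X^k\,d\mu$. *)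

theory Defs
  imports "HOL-Probability.Probability" "HOL-Computational_Algebra.Polynomial"
begin

text \<open>
  Elements of the real Hilbert space \<open>L\<^sup>2(E, \<mu>)\<close> are represented by square-integrable
  functions on \<open>M\<close>, and equality in \<open>L\<^sup>2\<close> is equality almost everywhere. An unbounded operator
  is a domain \<open>D\<close> together with a map \<open>L\<close> that is only meaningful on \<open>D\<close>.
\<close>

definition L2_space :: "'a measure \<Rightarrow> ('a \<Rightarrow> real) set" where
  "L2_space M = {X \<in> borel_measurable M. integrable M (\<lambda>x. (X x)\<^sup>2)}"

definition Lr_norm :: "'a measure \<Rightarrow> real \<Rightarrow> ('a \<Rightarrow> real) \<Rightarrow> real" where
  "Lr_norm M r X = (\<integral>x. \<bar>X x\<bar> powr r \<partial>M) powr (1 / r)"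

definition moment :: "'a measure \<Rightarrow> nat \<Rightarrow> ('a \<Rightarrow> real) \<Rightarrow> real" where
  "moment M k X = (\<integral>x. (X x) ^ k \<partial>M)"

definition L2_operator ::
    "'a measure \<Rightarrow> ('a \<Rightarrow> real) set \<Rightarrow> (('a \<Rightarrow> real) \<Rightarrow> 'a \<Rightarrow> real) \<Rightarrow> bool" where
  "L2_operator M D L \<longleftrightarrow>
     D \<subseteq> L2_space M \<and> (\<forall>X\<in>D. L X \<in> L2_space M) \<and>
     (\<forall>X\<in>D. \<forall>Y\<in>borel_measurable M. (AE x in M. X x = Y x) \<longrightarrow>
        Y \<in> D \<and> (AE x in M. L X x = L Y x)) \<and>
     (\<lambda>_. 0) \<in> D \<and>
     (\<forall>X\<in>D. \<forall>Y\<in>D. \<forall>a b. (\<lambda>x. a * X x + b * Y x) \<in> D \<and>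
        (AE x in M. L (\<lambda>x. a * X x + b * Y x) x = a * L X x + b * L Y x))"

text \<open>
  Self-adjointness means that the graph of the adjoint is the graph of the operator itself, which
  is stronger than symmetry.
\<close>

definition L2_adjoint_graph :: "'a measure \<Rightarrow> ('a \<Rightarrow> real) set \<Rightarrow>
    (('a \<Rightarrow> real) \<Rightarrow> 'a \<Rightarrow> real) \<Rightarrow> (('a \<Rightarrow> real) \<times> ('a \<Rightarrow> real)) set" where
  "L2_adjoint_graph M D L = {(Y, Z). Y \<in> L2_space M \<and> Z \<in> L2_space M \<and>
     (\<forall>X\<in>D. (\<integral>x. L X x * Y x \<partial>M) = (\<integral>x. X x * Z x \<partial>M))}"

definition L2_selfadjoint ::
    "'a measure \<Rightarrow> ('a \<Rightarrow> real) set \<Rightarrow> (('a \<Rightarrow> real) \<Rightarrow> 'a \<Rightarrow> real) \<Rightarrow> bool" where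
  "L2_selfadjoint M D L \<longleftrightarrow>
     L2_operator M D L \<and>
     (\<forall>X\<in>L2_space M. \<forall>e>0. \<exists>Y\<in>D. Lr_norm M 2 (\<lambda>x. X x - Y x) < e) \<and>
     L2_adjoint_graph M D L = {(Y, Z). Y \<in> D \<and> Z \<in> L2_space M \<and> (AE x in M. L Y x = Z x)}"

definition symmetric_markov_generator ::
    "'a measure \<Rightarrow> ('a \<Rightarrow> real) set \<Rightarrow> (('a \<Rightarrow> real) \<Rightarrow> 'a \<Rightarrow> real) \<Rightarrow> bool" where
  "symmetric_markov_generator M D L \<longleftrightarrow>
     prob_space M \<and> L2_selfadjoint M D L \<and>
     (\<lambda>_. 1) \<in> D \<and> (AE x in M. L (\<lambda>_. 1) x = 0)"

text \<open>
  The lower bound in the resolvent set yields both injectivity and boundedness of the inverse. Only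
  real spectral values are considered: the operators below are self-adjoint, so no others arise.
\<close>

definition L2_resolvent_set ::
    "'a measure \<Rightarrow> ('a \<Rightarrow> real) set \<Rightarrow> (('a \<Rightarrow> real) \<Rightarrow> 'a \<Rightarrow> real) \<Rightarrow> real set" where
  "L2_resolvent_set M D T = {z.
     (\<forall>Y\<in>L2_space M. \<exists>X\<in>D. AE x in M. T X x - z * X x = Y x) \<and>
     (\<exists>C. \<forall>X\<in>D. Lr_norm M 2 X \<le> C * Lr_norm M 2 (\<lambda>x. T X x - z * X x))}"

definition L2_spectrum ::
    "'a measure \<Rightarrow> ('a \<Rightarrow> real) set \<Rightarrow> (('a \<Rightarrow> real) \<Rightarrow> 'a \<Rightarrow> real) \<Rightarrow> real set" where
  "L2_spectrum M D T = - L2_resolvent_set M D T"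

text \<open>The eigenspace \<open>Ker(L + c Id)\<close>.\<close>

definition eigenspace ::
    "'a measure \<Rightarrow> ('a \<Rightarrow> real) set \<Rightarrow> (('a \<Rightarrow> real) \<Rightarrow> 'a \<Rightarrow> real) \<Rightarrow> real \<Rightarrow> ('a \<Rightarrow> real) set" where
  "eigenspace M D L c = {X \<in> D. AE x in M. L X x + c * X x = 0}"

text \<open>
  The spectrum of \<open>-L\<close> is \<open>{lam 0 < lam 1 < ...}\<close>, and \<open>L\<^sup>2\<close> is the Hilbert direct sum of the
  eigenspaces. Eigenspaces may have infinite dimension, as for the Ornstein--Uhlenbeck generator on
  Wiener space.
\<close>

definition discrete_spectrum :: "'a measure \<Rightarrow> ('a \<Rightarrow> real) set \<Rightarrow>
    (('a \<Rightarrow> real) \<Rightarrow> 'a \<Rightarrow> real) \<Rightarrow> (nat \<Rightarrow> real) \<Rightarrow> bool" where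
  "discrete_spectrum M D L lam \<longleftrightarrow>
     lam 0 = 0 \<and> strict_mono lam \<and>
     L2_spectrum M D (\<lambda>X x. - L X x) = range lam \<and>
     (\<forall>j k. j \<noteq> k \<longrightarrow> (\<forall>X\<in>eigenspace M D L (lam j). \<forall>Y\<in>eigenspace M D L (lam k).
        (\<integral>x. X x * Y x \<partial>M) = 0)) \<and>
     (\<forall>X\<in>L2_space M. \<exists>Y. (\<forall>k. Y k \<in> eigenspace M D L (lam k)) \<and>
        (\<lambda>n. Lr_norm M 2 (\<lambda>x. X x - (\<Sum>k<n. Y k x))) \<longlonglongrightarrow> 0)"

definition carre_du_champ ::
    "(('a \<Rightarrow> real) \<Rightarrow> 'a \<Rightarrow> real) \<Rightarrow> ('a \<Rightarrow> real) \<Rightarrow> ('a \<Rightarrow> real) \<Rightarrow> 'a \<Rightarrow> real" where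
  "carre_du_champ L X Y = (\<lambda>x. (L (\<lambda>y. X y * Y y) x - X x * L Y x - Y x * L X x) / 2)"

text \<open>\<open>\<Gamma>(X, Y)\<close> is meaningful when its three applications of \<open>L\<close> are.\<close>

definition carre_du_champ_defined ::
    "('a \<Rightarrow> real) set \<Rightarrow> ('a \<Rightarrow> real) \<Rightarrow> ('a \<Rightarrow> real) \<Rightarrow> bool" where
  "carre_du_champ_defined D X Y \<longleftrightarrow> X \<in> D \<and> Y \<in> D \<and> (\<lambda>x. X x * Y x) \<in> D"

definition integration_by_parts ::
    "'a measure \<Rightarrow> ('a \<Rightarrow> real) set \<Rightarrow> (('a \<Rightarrow> real) \<Rightarrow> 'a \<Rightarrow> real) \<Rightarrow> bool" where
  "integration_by_parts M D L \<longleftrightarrow>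
     (\<forall>X Y. carre_du_champ_defined D X Y \<longrightarrow>
        (\<integral>x. carre_du_champ L X Y x \<partial>M) = - (\<integral>x. X x * L Y x \<partial>M) \<and>
        (\<integral>x. carre_du_champ L X Y x \<partial>M) = - (\<integral>x. Y x * L X x \<partial>M))"

definition smooth :: "(real \<Rightarrow> real) \<Rightarrow> bool" where
  "smooth \<phi> \<longleftrightarrow> (\<forall>n x. (deriv ^^ n) \<phi> differentiable at x)"

definition bounded_smooth :: "(real \<Rightarrow> real) \<Rightarrow> bool" where
  "bounded_smooth \<phi> \<longleftrightarrow> smooth \<phi> \<and> (\<forall>n. bounded (range ((deriv ^^ n) \<phi>)))"

text \<open>
  The chain rules are required whenever both sides are meaningful, that is, whenever all functions
  to which \<open>L\<close> is applied lie in its domain.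
\<close>

definition diffusive ::
    "'a measure \<Rightarrow> ('a \<Rightarrow> real) set \<Rightarrow> (('a \<Rightarrow> real) \<Rightarrow> 'a \<Rightarrow> real) \<Rightarrow> bool" where
  "diffusive M D L \<longleftrightarrow>
     (\<forall>X \<phi>. carre_du_champ_defined D X X \<longrightarrow> smooth \<phi> \<longrightarrow> \<phi> \<circ> X \<in> D \<longrightarrow>
        (AE x in M. L (\<phi> \<circ> X) x =
           deriv \<phi> (X x) * L X x + deriv (deriv \<phi>) (X x) * carre_du_champ L X X x) \<and>
        (carre_du_champ_defined D (\<phi> \<circ> X) X \<longrightarrow>
          (AE x in M. carre_du_champ L (\<phi> \<circ> X) X x = deriv \<phi> (X x) * carre_du_champ L X X x)) \<and>
        (carre_du_champ_defined D (\<phi> \<circ> X) (\<phi> \<circ> X) \<longrightarrow>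
          (AE x in M. carre_du_champ L (\<phi> \<circ> X) (\<phi> \<circ> X) x =
             (deriv \<phi> (X x))\<^sup>2 * carre_du_champ L X X x)))"

text \<open>
  The standing assumption that the expressions in the integration by parts formula and in the chain
  rules are meaningful when \<open>X\<close> is an eigenfunction and \<open>\<phi>\<close> is a polynomial or a bounded smooth
  function with bounded derivatives. The formulas themselves are then supplied by
  \<open>integration_by_parts\<close> and \<open>diffusive\<close>. For \<open>\<phi>\<close> the identity polynomial this includes
  \<open>X\<^sup>2 \<in> D\<close>.
\<close>

definition eigenfunction_calculus :: "'a measure \<Rightarrow> ('a \<Rightarrow> real) set \<Rightarrow>
    (('a \<Rightarrow> real) \<Rightarrow> 'a \<Rightarrow> real) \<Rightarrow> (nat \<Rightarrow> real) \<Rightarrow> bool" where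
  "eigenfunction_calculus M D L lam \<longleftrightarrow>
     (\<forall>k. \<forall>X\<in>eigenspace M D L (lam k). \<forall>\<phi>. (\<exists>q. \<phi> = poly q) \<or> bounded_smooth \<phi> \<longrightarrow>
        carre_du_champ_defined D (\<phi> \<circ> X) X \<and> carre_du_champ_defined D (\<phi> \<circ> X) (\<phi> \<circ> X))"

text \<open>
  Integrability is stated separately because \<open>Lr_norm\<close> is zero on functions that are not in
  \<open>L\<^sup>r\<close>.
\<close>

definition hypercontractive :: "'a measure \<Rightarrow> ('a \<Rightarrow> real) set \<Rightarrow>
    (('a \<Rightarrow> real) \<Rightarrow> 'a \<Rightarrow> real) \<Rightarrow> (nat \<Rightarrow> real) \<Rightarrow> bool" where
  "hypercontractive M D L lam \<longleftrightarrow>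
     (\<forall>k. \<forall>r\<ge>2. \<exists>C. \<forall>X\<in>eigenspace M D L (lam k).
        integrable M (\<lambda>x. \<bar>X x\<bar> powr r) \<and> Lr_norm M r X \<le> C * Lr_norm M 2 X)"

definition chaos_eigenfunction :: "'a measure \<Rightarrow> ('a \<Rightarrow> real) set \<Rightarrow>
    (('a \<Rightarrow> real) \<Rightarrow> 'a \<Rightarrow> real) \<Rightarrow> (nat \<Rightarrow> real) \<Rightarrow> nat \<Rightarrow> ('a \<Rightarrow> real) \<Rightarrow> bool" where
  "chaos_eigenfunction M D L lam p X \<longleftrightarrow>
     X \<in> D \<and> (AE x in M. L X x = - lam p * X x) \<and>
     (\<exists>Y. (\<forall>k\<le>2 * p. Y k \<in> eigenspace M D L (lam k)) \<and>
        (AE x in M. (X x)\<^sup>2 = (\<Sum>k\<le>2 * p. Y k x)))"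

end

theory Submission
  imports Defs
begin

text \<open>
  Write \<open>\<Gamma>\<close> for \<open>\<Gamma>(X, X)\<close> and \<open>X\<^sup>2 = \<Sum>k\<le>2p. Y\<^sub>k\<close> for the chaos decomposition. The definition of the
  carre du champ and the eigenvalue equation give \<open>\<Gamma> = (L + 2 \<lambda>\<^sub>p) X\<^sup>2 / 2 = \<Sum>k\<le>2p. c\<^sub>k Y\<^sub>k\<close> with
  \<open>c\<^sub>k = \<lambda>\<^sub>p - \<lambda>\<^sub>k / 2\<close> (lemma \<open>carre_du_champ_chaos_expansion\<close>). Since the eigenvalues increase from
  \<open>0\<close> to \<open>\<lambda>\<^bsub>2p\<^esub> \<le> 2 \<lambda>\<^sub>p\<close>, all the multipliers satisfy \<open>0 \<le> c\<^sub>k \<le> \<lambda>\<^sub>p\<close>. The \<open>Y\<^sub>k\<close> are orthogonal, so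
  one factor \<open>c\<^sub>k\<close> can be replaced by its upper bound (lemma \<open>integral_multiplier_square_le\<close>):
  \<open>\<integral>\<Gamma>\<^sup>2 = \<Sum>k. c\<^sub>k\<^sup>2 \<parallel>Y\<^sub>k\<parallel>\<^sup>2 \<le> \<lambda>\<^sub>p (\<Sum>k. c\<^sub>k \<parallel>Y\<^sub>k\<parallel>\<^sup>2) = \<lambda>\<^sub>p \<integral>X\<^sup>2 \<Gamma>\<close>.

  The last integral is a moment: the chain rule and integration by parts give
  \<open>3 \<integral>X\<^sup>2 \<Gamma> = \<integral>\<Gamma>(X\<^sup>3, X) = \<lambda>\<^sub>p m\<^sub>4(X)\<close>. Hence \<open>\<integral>\<Gamma>\<^sup>2 \<le> \<lambda>\<^sub>p\<^sup>2 m\<^sub>4(X) / 3\<close>, and expanding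
  \<open>(\<Gamma> - \<lambda>\<^sub>p)\<^sup>2\<close> with \<open>\<integral>\<Gamma> = \<lambda>\<^sub>p m\<^sub>2(X)\<close> yields the bound.
\<close>

section \<open>Orthogonal expansions in \<open>L\<^sup>2\<close>\<close>

lemma L2_spaceD:
  assumes "X \<in> L2_space M"
  shows "X \<in> borel_measurable M" and "integrable M (\<lambda>x. (X x)\<^sup>2)"
  using assms by (auto simp: L2_space_def)

lemma L2_space_mult_integrable:
  assumes "X \<in> L2_space M" and "Y \<in> L2_space M"
  shows "integrable M (\<lambda>x. X x * Y x)"
proof (rule Bochner_Integration.integrable_bound)
  show "integrable M (\<lambda>x. (X x)\<^sup>2 + (Y x)\<^sup>2)"
    using L2_spaceD(2)[OF assms(1)] L2_spaceD(2)[OF assms(2)] by simp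
  show "(\<lambda>x. X x * Y x) \<in> borel_measurable M"
    using L2_spaceD(1)[OF assms(1)] L2_spaceD(1)[OF assms(2)] by simp
  have "\<bar>a * b\<bar> \<le> a\<^sup>2 + b\<^sup>2" for a b :: real
    using sum_squares_bound[of a b] sum_squares_bound[of a "- b"] sum_power2_ge_zero[of a b]
    by (auto simp: abs_if power2_eq_square)
  then show "AE x in M. norm (X x * Y x) \<le> norm ((X x)\<^sup>2 + (Y x)\<^sup>2)"
    by simp
qed

text \<open>A finite Parseval identity.\<close>

lemma integral_orthogonal_sum_mult:
  fixes Y :: "'i \<Rightarrow> 'a \<Rightarrow> real"
  assumes "finite I" and L2: "\<And>i. i \<in> I \<Longrightarrow> Y i \<in> L2_space M"
    and orth: "\<And>i j. i \<in> I \<Longrightarrow> j \<in> I \<Longrightarrow> i \<noteq> j \<Longrightarrow> (\<integral>x. Y i x * Y j x \<partial>M) = 0"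
  shows "(\<integral>x. (\<Sum>i\<in>I. a i * Y i x) * (\<Sum>j\<in>I. b j * Y j x) \<partial>M)
    = (\<Sum>i\<in>I. a i * b i * (\<integral>x. (Y i x)\<^sup>2 \<partial>M))"
proof -
  have int: "integrable M (\<lambda>x. Y i x * Y j x)" if "i \<in> I" "j \<in> I" for i j
    using that L2 by (intro L2_space_mult_integrable)
  have "(\<integral>x. (\<Sum>i\<in>I. a i * Y i x) * (\<Sum>j\<in>I. b j * Y j x) \<partial>M)
      = (\<integral>x. (\<Sum>i\<in>I. \<Sum>j\<in>I. (a i * b j) * (Y i x * Y j x)) \<partial>M)"
    by (simp add: sum_product mult_ac)
  also have "\<dots> = (\<Sum>i\<in>I. \<Sum>j\<in>I. (a i * b j) * (\<integral>x. Y i x * Y j x \<partial>M))"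
    using int by (simp add: Bochner_Integration.integral_sum)
  also have "\<dots> = (\<Sum>i\<in>I. a i * b i * (\<integral>x. (Y i x)\<^sup>2 \<partial>M))"
  proof (intro sum.cong refl)
    fix i assume i: "i \<in> I"
    have "(\<Sum>j\<in>I. (a i * b j) * (\<integral>x. Y i x * Y j x \<partial>M))
        = (\<Sum>j\<in>I. if j = i then a i * b i * (\<integral>x. (Y i x)\<^sup>2 \<partial>M) else 0)"
      using i by (intro sum.cong refl) (auto simp: orth power2_eq_square)
    then show "(\<Sum>j\<in>I. (a i * b j) * (\<integral>x. Y i x * Y j x \<partial>M)) = a i * b i * (\<integral>x. (Y i x)\<^sup>2 \<partial>M)"
      using i \<open>finite I\<close> by simp
  qed
  finally show ?thesis .
qed

text \<open>
  A diagonal operator \<open>T\<close> with multipliers in \<open>[0, c]\<close> satisfies \<open>T\<^sup>2 \<le> c T\<close> as quadratic forms; here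
  the forms are evaluated at \<open>\<Sum>i. Y\<^sub>i\<close>.
\<close>

lemma integral_multiplier_square_le:
  fixes Y :: "'i \<Rightarrow> 'a \<Rightarrow> real"
  assumes "finite I" and "\<And>i. i \<in> I \<Longrightarrow> Y i \<in> L2_space M"
    and "\<And>i j. i \<in> I \<Longrightarrow> j \<in> I \<Longrightarrow> i \<noteq> j \<Longrightarrow> (\<integral>x. Y i x * Y j x \<partial>M) = 0"
    and a: "\<And>i. i \<in> I \<Longrightarrow> 0 \<le> a i" "\<And>i. i \<in> I \<Longrightarrow> a i \<le> c"
  shows "(\<integral>x. (\<Sum>i\<in>I. a i * Y i x)\<^sup>2 \<partial>M)
    \<le> c * (\<integral>x. (\<Sum>i\<in>I. Y i x) * (\<Sum>i\<in>I. a i * Y i x) \<partial>M)"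
proof -
  note parseval = integral_orthogonal_sum_mult[of I Y M, OF assms(1-3)]
  have "(\<integral>x. (\<Sum>i\<in>I. a i * Y i x)\<^sup>2 \<partial>M) = (\<Sum>i\<in>I. a i * a i * (\<integral>x. (Y i x)\<^sup>2 \<partial>M))"
    using parseval[of a a] by (simp add: power2_eq_square)
  also have "\<dots> \<le> (\<Sum>i\<in>I. c * a i * (\<integral>x. (Y i x)\<^sup>2 \<partial>M))"
    using a by (intro sum_mono mult_right_mono) auto
  also have "\<dots> = c * (\<integral>x. (\<Sum>i\<in>I. Y i x) * (\<Sum>i\<in>I. a i * Y i x) \<partial>M)"
    using parseval[of "\<lambda>_. 1" a] by (simp add: sum_distrib_left mult.assoc)
  finally show ?thesis .
qed

section \<open>The carre du champ of a chaos eigenfunction\<close>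

lemma L2_operator_cong:
  assumes "L2_operator M D L" and "X \<in> D" and "Y \<in> borel_measurable M"
    and "AE x in M. X x = Y x"
  shows "AE x in M. L X x = L Y x"
proof -
  have "\<forall>X\<in>D. \<forall>Y\<in>borel_measurable M. (AE x in M. X x = Y x) \<longrightarrow>
      Y \<in> D \<and> (AE x in M. L X x = L Y x)"
    using assms(1) by (simp add: L2_operator_def)
  from this[rule_format, OF assms(2-4)] show ?thesis
    by simp
qed

lemma L2_operator_sum:
  assumes op: "L2_operator M D L" and "finite I" and "\<And>i. i \<in> I \<Longrightarrow> Y i \<in> D"
  shows "(\<lambda>x. \<Sum>i\<in>I. Y i x) \<in> D \<and>
    (AE x in M. L (\<lambda>x. \<Sum>i\<in>I. Y i x) x = (\<Sum>i\<in>I. L (Y i) x))"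
  using assms(2,3)
proof (induction I rule: finite_induct)
  have lin: "(\<lambda>x. a * U x + b * V x) \<in> D \<and>
      (AE x in M. L (\<lambda>x. a * U x + b * V x) x = a * L U x + b * L V x)"
    if "U \<in> D" "V \<in> D" for U V a b
    using op that by (simp add: L2_operator_def)
  {
    case empty
    have "(\<lambda>_. 0) \<in> D"
      using op by (simp add: L2_operator_def)
    with lin[of "\<lambda>_. 0" "\<lambda>_. 0" 0 0] show ?case
      by simp
  next
    case (insert i I)
    then have D: "(\<lambda>x. \<Sum>i\<in>I. Y i x) \<in> D" "Y i \<in> D"
      and AE: "AE x in M. L (\<lambda>x. \<Sum>i\<in>I. Y i x) x = (\<Sum>i\<in>I. L (Y i) x)"
      by auto
    from lin[OF D(2,1), of 1 1] AE insert.hyps show ?case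
      by auto
  }
qed

text \<open>
  By the eigenvalue equation \<open>2 \<Gamma>(X, X) = (L + 2 \<lambda>) X\<^sup>2\<close>, and \<open>L\<close> acts on an eigenspace
  decomposition of \<open>X\<^sup>2\<close> term by term.
\<close>

lemma carre_du_champ_chaos_expansion:
  assumes op: "L2_operator M D L" and X: "X \<in> eigenspace M D L c" and "finite I"
    and Y: "\<And>i. i \<in> I \<Longrightarrow> Y i \<in> eigenspace M D L (d i)"
    and X2: "AE x in M. (X x)\<^sup>2 = (\<Sum>i\<in>I. Y i x)"
    and X2D: "(\<lambda>x. X x * X x) \<in> D"
  shows "AE x in M. carre_du_champ L X X x = (\<Sum>i\<in>I. (c - d i / 2) * Y i x)"
proof -
  have YD: "\<And>i. i \<in> I \<Longrightarrow> Y i \<in> D"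
    using Y by (auto simp: eigenspace_def)
  have sum: "(\<lambda>x. \<Sum>i\<in>I. Y i x) \<in> D"
    "AE x in M. L (\<lambda>x. \<Sum>i\<in>I. Y i x) x = (\<Sum>i\<in>I. L (Y i) x)"
    using L2_operator_sum[OF op \<open>finite I\<close> YD] by auto
  have "(\<lambda>x. \<Sum>i\<in>I. Y i x) \<in> borel_measurable M"
    using sum(1) op by (auto simp: L2_operator_def L2_space_def)
  moreover have "AE x in M. X x * X x = (\<Sum>i\<in>I. Y i x)"
    using X2 by (simp add: power2_eq_square)
  ultimately have "AE x in M. L (\<lambda>x. X x * X x) x = L (\<lambda>x. \<Sum>i\<in>I. Y i x) x"
    by (rule L2_operator_cong[OF op X2D])
  moreover have "AE x in M. \<forall>i\<in>I. L (Y i) x + d i * Y i x = 0"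
    using \<open>finite I\<close> Y by (intro AE_finite_allI) (auto simp: eigenspace_def)
  moreover have "AE x in M. L X x + c * X x = 0"
    using X by (simp add: eigenspace_def)
  ultimately show ?thesis
    using sum(2) X2
  proof eventually_elim
    case (elim x)
    have "L (\<lambda>x. X x * X x) x = (\<Sum>i\<in>I. - d i * Y i x)"
      using elim by (auto intro!: sum.cong simp: eq_neg_iff_add_eq_0)
    moreover have "L X x = - c * X x"
      using elim by (simp add: eq_neg_iff_add_eq_0)
    ultimately have "carre_du_champ L X X x = (\<Sum>i\<in>I. - d i * Y i x) / 2 + c * (X x)\<^sup>2"
      by (simp add: carre_du_champ_def power2_eq_square field_simps)
    also have "\<dots> = (\<Sum>i\<in>I. (c - d i / 2) * Y i x)"
      unfolding elim(5)
      by (simp add: sum_distrib_left sum_divide_distrib flip: sum.distrib)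
        (simp add: algebra_simps)
    finally show ?case .
  qed
qed

section \<open>The fourth moment as an energy\<close>

lemma deriv_poly: "deriv (poly q) = poly (pderiv q)" for q :: "real poly"
  by (intro ext DERIV_imp_deriv poly_DERIV)

lemma smooth_poly: "smooth (poly q)"
proof -
  have "(deriv ^^ n) (poly q) = poly ((pderiv ^^ n) q)" for n
    by (induction n) (simp_all add: deriv_poly)
  then show ?thesis
    by (simp add: smooth_def)
qed

lemma eigenspace_powers_in_domain:
  assumes "eigenfunction_calculus M D L lam" and "X \<in> eigenspace M D L (lam k)"
  shows "carre_du_champ_defined D X X"
    and "carre_du_champ_defined D (\<lambda>x. X x ^ 3) X"
proof -
  have "carre_du_champ_defined D (poly (monom 1 n) \<circ> X) X" for n
    using assms unfolding eigenfunction_calculus_def by blast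
  from this[of 1] this[of 3] show "carre_du_champ_defined D X X"
    and "carre_du_champ_defined D (\<lambda>x. X x ^ 3) X"
    by (simp_all add: comp_def poly_monom)
qed

lemma integral_mult_eigenfunction:
  assumes "X \<in> eigenspace M D L c"
    and "D \<subseteq> L2_space M" and "\<And>U. U \<in> D \<Longrightarrow> L U \<in> L2_space M" and "Z \<in> D"
  shows "(\<integral>x. Z x * L X x \<partial>M) = - c * (\<integral>x. Z x * X x \<partial>M)"
proof -
  have XD: "X \<in> D" and eq: "AE x in M. L X x + c * X x = 0"
    using assms(1) by (auto simp: eigenspace_def)
  from eq have "AE x in M. Z x * L X x = - c * (Z x * X x)"
  proof eventually_elim
    case (elim x)
    then have "L X x = - c * X x"
      by simp
    then show ?case
      by simp
  qed
  moreover have "Z \<in> borel_measurable M" "X \<in> borel_measurable M" "L X \<in> borel_measurable M"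
    using XD assms(2-4) by (blast intro: L2_spaceD(1))+
  ultimately have "(\<integral>x. Z x * L X x \<partial>M) = (\<integral>x. - c * (Z x * X x) \<partial>M)"
    by (intro integral_cong_AE) auto
  then show ?thesis
    by simp
qed

text \<open>
  The chain rule turns \<open>3 X\<^sup>2 \<Gamma>(X, X)\<close> into \<open>\<Gamma>(X\<^sup>3, X)\<close>, which integration by parts reduces to a
  fourth moment.
\<close>

lemma integral_square_mult_carre_du_champ:
  assumes op: "L2_operator M D L" and ibp: "integration_by_parts M D L"
    and diff: "diffusive M D L" and calc: "eigenfunction_calculus M D L lam"
    and X: "X \<in> eigenspace M D L (lam k)"
  shows "(\<integral>x. (X x)\<^sup>2 * carre_du_champ L X X x \<partial>M) = lam k / 3 * moment M 4 X"
proof -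
  have DL2: "D \<subseteq> L2_space M" and LL2: "\<And>U. U \<in> D \<Longrightarrow> L U \<in> L2_space M"
    using op by (auto simp: L2_operator_def)
  have meas: "U \<in> borel_measurable M" "L U \<in> borel_measurable M" if "U \<in> D" for U
    using that DL2 LL2 L2_spaceD(1) by blast+
  note def = eigenspace_powers_in_domain[OF calc X]
  have D: "X \<in> D" "(\<lambda>x. X x * X x) \<in> D" "(\<lambda>x. X x ^ 3) \<in> D" "(\<lambda>x. X x ^ 3 * X x) \<in> D"
    using def by (auto simp: carre_du_champ_defined_def)
  have cube: "poly (monom 1 3) \<circ> X = (\<lambda>x. X x ^ 3)"
    by (simp add: comp_def poly_monom)
  have "AE x in M. carre_du_champ L (\<lambda>x. X x ^ 3) X x
      = deriv (poly (monom 1 3)) (X x) * carre_du_champ L X X x"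
    using diff def D(3) smooth_poly[of "monom 1 3"] unfolding diffusive_def cube[symmetric]
    by blast
  then have "AE x in M. carre_du_champ L (\<lambda>x. X x ^ 3) X x
      = 3 * ((X x)\<^sup>2 * carre_du_champ L X X x)"
    by (simp add: deriv_poly pderiv_monom poly_monom mult.assoc)
  then have "(\<integral>x. carre_du_champ L (\<lambda>x. X x ^ 3) X x \<partial>M)
      = (\<integral>x. 3 * ((X x)\<^sup>2 * carre_du_champ L X X x) \<partial>M)"
    using meas[OF D(1)] meas[OF D(2)] meas[OF D(3)] meas[OF D(4)]
    by (intro integral_cong_AE) (simp_all add: carre_du_champ_def)
  moreover have "(\<integral>x. carre_du_champ L (\<lambda>x. X x ^ 3) X x \<partial>M) = lam k * moment M 4 X"
  proof -
    have "(\<integral>x. carre_du_champ L (\<lambda>x. X x ^ 3) X x \<partial>M) = - (\<integral>x. X x ^ 3 * L X x \<partial>M)"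
      using ibp def(2) by (simp add: integration_by_parts_def)
    also have "\<dots> = lam k * (\<integral>x. X x ^ 3 * X x \<partial>M)"
      using integral_mult_eigenfunction[OF X DL2 LL2 D(3)] by simp
    finally show ?thesis
      by (simp add: moment_def eval_nat_numeral mult_ac)
  qed
  ultimately show ?thesis
    by simp
qed

section \<open>The fourth moment bound\<close>

theorem theorem3p2:
  fixes M :: "'a measure" and D :: "('a \<Rightarrow> real) set"
    and L :: "('a \<Rightarrow> real) \<Rightarrow> 'a \<Rightarrow> real"
    and lam :: "nat \<Rightarrow> real" and p :: nat and X :: "'a \<Rightarrow> real"
  assumes "symmetric_markov_generator M D L"
    and "discrete_spectrum M D L lam"
    and "integration_by_parts M D L"
    and "diffusive M D L"
    and "eigenfunction_calculus M D L lam"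
    and "hypercontractive M D L lam"
    and "chaos_eigenfunction M D L lam p X"
    and "lam (2 * p) \<le> 2 * lam p"
  shows "integrable M (\<lambda>x. (carre_du_champ L X X x - lam p)\<^sup>2) \<and>
    integrable M (\<lambda>x. (X x) ^ 4) \<and>
    (\<integral>x. (carre_du_champ L X X x - lam p)\<^sup>2 \<partial>M)
      \<le> (lam p)\<^sup>2 / 3 * (moment M 4 X - 6 * moment M 2 X + 3)"
proof -
  let ?G = "carre_du_champ L X X"
  interpret prob_space M
    using assms(1) by (simp add: symmetric_markov_generator_def)
  have op: "L2_operator M D L"
    using assms(1) by (simp add: symmetric_markov_generator_def L2_selfadjoint_def)
  have DL2: "D \<subseteq> L2_space M" and LL2: "\<And>U. U \<in> D \<Longrightarrow> L U \<in> L2_space M"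
    using op by (auto simp: L2_operator_def)
  have lam: "lam 0 = 0" "strict_mono lam"
    and orth: "\<And>j k U V. j \<noteq> k \<Longrightarrow> U \<in> eigenspace M D L (lam j) \<Longrightarrow>
      V \<in> eigenspace M D L (lam k) \<Longrightarrow> (\<integral>x. U x * V x \<partial>M) = 0"
    using assms(2) by (auto simp: discrete_spectrum_def)
  have X: "X \<in> eigenspace M D L (lam p)"
    using assms(7) by (auto simp: chaos_eigenfunction_def eigenspace_def)
  obtain Y where Y: "\<And>k. k \<le> 2 * p \<Longrightarrow> Y k \<in> eigenspace M D L (lam k)"
    and X2: "AE x in M. (X x)\<^sup>2 = (\<Sum>k\<le>2 * p. Y k x)"
    using assms(7) by (auto simp: chaos_eigenfunction_def)
  have YL2: "Y k \<in> L2_space M" if "k \<le> 2 * p" for k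
    using Y[OF that] DL2 by (auto simp: eigenspace_def)
  have def: "carre_du_champ_defined D X X"
    by (rule eigenspace_powers_in_domain[OF assms(5) X])
  then have XD: "X \<in> D" and X2D: "(\<lambda>x. X x * X x) \<in> D"
    by (auto simp: carre_du_champ_defined_def)
  \<comment> \<open>The domain consists of square-integrable functions, so \<open>X\<^sup>2 \<in> D\<close> has a finite second moment.\<close>
  have X4: "integrable M (\<lambda>x. X x ^ 4)"
    using L2_spaceD(2)[of "\<lambda>x. X x * X x" M] X2D DL2
    by (auto simp: power2_eq_square eval_nat_numeral mult_ac)

  define c where "c k = lam p - lam k / 2" for k
  have G: "AE x in M. ?G x = (\<Sum>k\<le>2 * p. c k * Y k x)"
    unfolding c_def
    by (rule carre_du_champ_chaos_expansion[OF op X _ _ X2 X2D]) (use Y in auto)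
  have c: "0 \<le> c k" "c k \<le> lam p" if "k \<le> 2 * p" for k
    using strict_mono_less_eq[OF lam(2), of k "2 * p"] strict_mono_less_eq[OF lam(2), of 0 k]
      that lam(1) assms(8) by (auto simp: c_def)

  have measG: "?G \<in> borel_measurable M"
    using XD X2D DL2 LL2[OF XD] LL2[OF X2D] unfolding carre_du_champ_def
    by (auto dest!: L2_spaceD(1) subsetD)
  have measX: "X \<in> borel_measurable M"
    using XD DL2 by (auto dest: L2_spaceD(1))
  have measY: "Y k \<in> borel_measurable M" if "k \<le> 2 * p" for k
    using YL2[OF that] by (rule L2_spaceD(1))
  have measS: "(\<lambda>x. \<Sum>k\<le>2 * p. c k * Y k x) \<in> borel_measurable M"
    "(\<lambda>x. \<Sum>k\<le>2 * p. Y k x) \<in> borel_measurable M"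
    using measY by (auto intro!: borel_measurable_sum)
  have "integrable M (\<lambda>x. (\<Sum>k\<le>2 * p. c k * Y k x)\<^sup>2)"
    unfolding power2_eq_square sum_product
  proof (intro Bochner_Integration.integrable_sum)
    fix j k assume "j \<in> {..2 * p}" "k \<in> {..2 * p}"
    then have "integrable M (\<lambda>x. (c j * c k) * (Y j x * Y k x))"
      using YL2 by (intro integrable_mult_right L2_space_mult_integrable) auto
    then show "integrable M (\<lambda>x. c j * Y j x * (c k * Y k x))"
      by (simp add: mult_ac)
  qed
  moreover have G2: "AE x in M. (?G x)\<^sup>2 = (\<Sum>k\<le>2 * p. c k * Y k x)\<^sup>2"
    using G by auto
  ultimately have intG2: "integrable M (\<lambda>x. (?G x)\<^sup>2)"
    using measG measS(1)
    by (subst integrable_cong_AE[where g = "\<lambda>x. (\<Sum>k\<le>2 * p. c k * Y k x)\<^sup>2"]) auto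
  have intG: "integrable M ?G"
    using measG intG2 by (rule square_integrable_imp_integrable)

  have "(\<integral>x. (?G x)\<^sup>2 \<partial>M) = (\<integral>x. (\<Sum>k\<le>2 * p. c k * Y k x)\<^sup>2 \<partial>M)"
    using G2 measG measS(1) by (intro integral_cong_AE) auto
  also have "\<dots> \<le> lam p * (\<integral>x. (\<Sum>k\<le>2 * p. Y k x) * (\<Sum>k\<le>2 * p. c k * Y k x) \<partial>M)"
    using YL2 Y c by (intro integral_multiplier_square_le) (auto intro: orth)
  also have "(\<integral>x. (\<Sum>k\<le>2 * p. Y k x) * (\<Sum>k\<le>2 * p. c k * Y k x) \<partial>M)
      = (\<integral>x. (X x)\<^sup>2 * ?G x \<partial>M)"
    using G X2 measG measS measX by (intro integral_cong_AE) auto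
  also have "\<dots> = lam p / 3 * moment M 4 X"
    using op assms(3-5) X by (rule integral_square_mult_carre_du_champ)
  finally have bound: "(\<integral>x. (?G x)\<^sup>2 \<partial>M) \<le> (lam p)\<^sup>2 / 3 * moment M 4 X"
    by (simp add: power2_eq_square)

  have mean: "(\<integral>x. ?G x \<partial>M) = lam p * moment M 2 X"
  proof -
    have "(\<integral>x. ?G x \<partial>M) = - (\<integral>x. X x * L X x \<partial>M)"
      using assms(3) def by (simp add: integration_by_parts_def)
    then show ?thesis
      using integral_mult_eigenfunction[OF X DL2 LL2 XD]
      by (simp add: moment_def power2_eq_square)
  qed

  have expand: "(\<lambda>x. (?G x - lam p)\<^sup>2) = (\<lambda>x. (?G x)\<^sup>2 - 2 * lam p * ?G x + (lam p)\<^sup>2)"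
    by (auto simp: power2_diff)
  have "(\<integral>x. (?G x - lam p)\<^sup>2 \<partial>M) = (\<integral>x. (?G x)\<^sup>2 \<partial>M) - 2 * lam p * (\<integral>x. ?G x \<partial>M) + (lam p)\<^sup>2"
    unfolding expand using intG intG2 by (simp add: prob_space)
  also have "\<dots> \<le> (lam p)\<^sup>2 / 3 * (moment M 4 X - 6 * moment M 2 X + 3)"
    using bound by (simp add: mean power2_eq_square algebra_simps)
  finally have "(\<integral>x. (?G x - lam p)\<^sup>2 \<partial>M)
      \<le> (lam p)\<^sup>2 / 3 * (moment M 4 X - 6 * moment M 2 X + 3)" .
  moreover have "integrable M (\<lambda>x. (?G x - lam p)\<^sup>2)"
    unfolding expand using intG intG2 by auto
  ultimately show ?thesis
    using X4 by simp
qed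

end
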